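(* Let $a,b,m\ge 1$ be integers. For non-negative integers $w,s,n$, let $\mathrm{cp}_{a,b,m}(w,s,n)$ be the number of $(a,b,m)$-copartitions $(\gamma,\rho,\sigma)$ of size $n$ such that $\gamma$ has exactly $w$ parts and $\sigma$ has exactly $s$ parts. Then $$\sum_{n=0}^\infty\sum_{w=0}^\infty\sum_{s=0}^\infty \mathrm{cp}_{a,b,m}(w,s,n)\,x^{s}y^{w}q^n=\frac{(xyq^{a+b};q^m)_\infty}{(xq^b;q^m)_\infty(yq^a;q^m)_\infty}.$$
   Context: A partition is a finite multiset of positive integers (its parts), possibly empty; its size $|\lambda|$ is the sum of its parts. For integers $a,b,m\ge 1$, an $(a,b,m)$-copartition is a triple of partitions $(\gamma,\rho,\sigma)$ such that each part of $\gamma$ is at least $a$ and congruent to $a \pmod m$, each part of $\sigma$ is at least $b$ and congruent to $b\pmod m$, and $\rho$ has the same number of parts as $\sigma$, each of which has size equal to $m$ times the number of parts of $\gamma$ (if $\gamma$ is empty, $\rho$ is regarded as empty). Its size is $|\gamma|+|\rho|+|\sigma|$. The parts of $\gamma$ are called ground parts and the parts of $\sigma$ sky parts. Notation: $(A;Q)_\infty=\prod_{k=0}^\infty(1-AQ^k)$. The identity may be read as an identity of formal power series in $q$ with coefficients in $\mathbb{Z}[x,y]$. *)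

theory Defs
  imports
    "HOL-Analysis.Analysis"
    "HOL-Computational_Algebra.Computational_Algebra"
    "HOL-Number_Theory.Cong"
    "HOL-Library.Multiset"
begin

text \<open>A partition is the multiset of its parts, so its size is \<^term>\<open>sum_mset\<close> and its number
  of parts is the multiset \<^term>\<open>size\<close>.\<close>

definition is_partition :: "nat multiset \<Rightarrow> bool" where
  "is_partition \<mu> \<longleftrightarrow> (\<forall>p \<in># \<mu>. 0 < p)"

definition is_copartition ::
    "nat \<Rightarrow> nat \<Rightarrow> nat \<Rightarrow> nat multiset \<times> nat multiset \<times> nat multiset \<Rightarrow> bool" where
  "is_copartition a b m = (\<lambda>(\<gamma>, \<rho>, \<sigma>).
     is_partition \<gamma> \<and> is_partition \<rho> \<and> is_partition \<sigma> \<and>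
     (\<forall>p \<in># \<gamma>. a \<le> p \<and> [p = a] (mod m)) \<and>
     (\<forall>p \<in># \<sigma>. b \<le> p \<and> [p = b] (mod m)) \<and>
     (if \<gamma> = {#} then \<rho> = {#}
      else size \<rho> = size \<sigma> \<and> (\<forall>p \<in># \<rho>. p = m * size \<gamma>)))"

definition cp :: "nat \<Rightarrow> nat \<Rightarrow> nat \<Rightarrow> nat \<Rightarrow> nat \<Rightarrow> nat \<Rightarrow> nat" where
  "cp a b m w s n = card {(\<gamma>, \<rho>, \<sigma>). is_copartition a b m (\<gamma>, \<rho>, \<sigma>) \<and>
     sum_mset \<gamma> + sum_mset \<rho> + sum_mset \<sigma> = n \<and> size \<gamma> = w \<and> size \<sigma> = s}"

text \<open>Formal power series in \<open>q\<close> over \<open>\<int>[x,y]\<close>. The coefficient ring is \<open>\<int>[x][y]\<close>: the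
  inner polynomial variable is \<open>x\<close>, the outer one is \<open>y\<close>. Infinite sums and products of series are
  the library's \<^term>\<open>suminf\<close> and \<^term>\<open>prodinf\<close>, taken in the \<open>q\<close>-adic topology.\<close>

type_synonym series = "int poly poly fps"

definition x_var :: series where "x_var = fps_const [:[:0, 1:]:]"
definition y_var :: series where "y_var = fps_const [:0, 1:]"
definition q_var :: series where "q_var = fps_X"

definition qpoch_inf :: "series \<Rightarrow> series \<Rightarrow> series" where
  "qpoch_inf A Q = (\<Prod>k. 1 - A * Q ^ k)"

text \<open>The library's division of power series needs an inverse operation on the coefficient ring,
  which \<open>\<int>[x,y]\<close> lacks. Denominators with constant coefficient 1 are nevertheless units.\<close>

definition fps_quot :: "series \<Rightarrow> series \<Rightarrow> series" where
  "fps_quot F G = F * fps_right_inverse G 1"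

lemma fps_quot_eq_iff:
  assumes "fps_nth G 0 = 1"
  shows "fps_quot F G = H \<longleftrightarrow> F = H * G"
proof -
  have 1: "G * fps_right_inverse G 1 = 1"
    by (rule fps_right_inverse) (simp add: assms)
  have 2: "fps_quot F G * G = F"
    using 1 by (simp add: fps_quot_def mult.assoc mult.commute[of _ G])
  have 3: "fps_quot (H * G) G = H"
    using 1 by (simp add: fps_quot_def mult.assoc)
  show ?thesis
    using 2 3 by metis
qed

end

theory Submission
  imports Defs
begin

text \<open>In a copartition with \<open>w\<close> ground parts and \<open>s\<close> sky parts, \<open>\<rho>\<close> is forced: it has size \<open>mws\<close>.
  What remains is a free choice of two partitions into parts from the progressions
  \<open>a, a + m, a + 2m, \<dots>\<close> and \<open>b, b + m, b + 2m, \<dots>\<close>. Writing \<open>g\<^sub>a(w)\<close> for the generating function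
  in \<open>q\<close> of the partitions into \<open>w\<close> parts from the first progression, the left-hand side is
  therefore (\<open>suminf_copartitions\<close>)
  \<open>\<Sum>w. g\<^sub>a(w) P(x q^(mw)) y^w\<close>, where \<open>P(Z) = (\<Sum>s. g\<^sub>b(s) Z^s)\<close>.

  Removing a part equal to \<open>a\<close>, or subtracting \<open>m\<close> from every part if there is none, gives
  \<open>g\<^sub>a(w + 1) (1 - q^(m(w + 1))) = q^a g\<^sub>a(w)\<close> (\<open>ap_series_Suc\<close>). Hence both sums are instances of the
  q-binomial theorem, in the following form (\<open>q_binomial\<close>): if
  \<open>c(w + 1) (1 - q^(m(w + 1))) = q^a (1 - u q^(mw)) c(w)\<close> for all \<open>w\<close>, then
  \<open>(Y q^a; q^m)\<^sub>\<infinity> (\<Sum>w. c(w) Y^w) = (u Y q^a; q^m)\<^sub>\<infinity> c(0)\<close>. It is proved by comparing the sum at \<open>Y\<close> with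
  the sum at \<open>Y q^m\<close>, iterating, and passing to the limit.

  With \<open>u = 0\<close> and \<open>c = g\<^sub>b\<close> the theorem says \<open>P(x) = 1 / (x q^b; q^m)\<^sub>\<infinity>\<close>, and the functional equation
  behind it says \<open>P(Z q^m) = (1 - Z q^b) P(Z)\<close>. The latter shows that \<open>c(w) = g\<^sub>a(w) P(x q^(mw))\<close>
  satisfies the recurrence with \<open>u = x q^b\<close>, and since \<open>c(0) = P(x)\<close> the second application gives
  the product formula.\<close>

unbundle no vec_syntax

section \<open>Limits, sums and products in the adic topology\<close>

lemma tendsto_mult_fps:
  fixes F G :: "'a::ring_1 fps"
  assumes "(f \<longlongrightarrow> F) net" "(g \<longlongrightarrow> G) net"
  shows "((\<lambda>x. f x * g x) \<longlongrightarrow> F * G) net"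
proof (rule tendsto_fpsI)
  fix n
  have "eventually (\<lambda>x. \<forall>i\<in>{..n}. f x $ i = F $ i) net"
    "eventually (\<lambda>x. \<forall>i\<in>{..n}. g x $ i = G $ i) net"
    using assms by (auto simp: tendsto_fps_iff intro!: eventually_ball_finite)
  then show "eventually (\<lambda>x. (f x * g x) $ n = (F * G) $ n) net"
    by eventually_elim (simp add: fps_mult_nth)
qed

text \<open>Families of power series whose \<open>w\<close>-th member has order at least \<open>w\<close>. They are summable in the
  adic topology, and the coefficient of the sum at \<open>n\<close> is a sum over \<open>w \<le> n\<close>; the explicit rate
  \<open>w\<close> suffices here because all parts are positive.\<close>

definition adic_family :: "(nat \<Rightarrow> 'a::zero fps) \<Rightarrow> bool" where
  "adic_family h \<longleftrightarrow> (\<forall>w n. n < w \<longrightarrow> h w $ n = 0)"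

lemma adic_family_mult:
  fixes h :: "nat \<Rightarrow> 'a::comm_ring_1 fps"
  assumes "adic_family h"
  shows "adic_family (\<lambda>w. h w * k w)"
  using assms by (auto simp: adic_family_def fps_mult_nth)

lemma suminf_fps_nth:
  fixes h :: "nat \<Rightarrow> 'a::comm_ring_1 fps"
  assumes "adic_family h" "n \<le> N"
  shows "(\<Sum>w. h w) $ n = (\<Sum>w\<le>N. h w $ n)"
proof -
  have tail: "(\<Sum>w\<in>A. h w $ n) = (\<Sum>w\<le>n. h w $ n)" if "{..n} \<subseteq> A" "finite A" for A n
    using that assms(1) by (intro sum.mono_neutral_right) (auto simp: adic_family_def)
  have "h sums Abs_fps (\<lambda>n. \<Sum>w\<le>n. h w $ n)"
    unfolding sums_def
  proof (rule tendsto_fpsI)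
    fix n
    show "eventually (\<lambda>M. sum h {..<M} $ n = Abs_fps (\<lambda>n. \<Sum>w\<le>n. h w $ n) $ n) sequentially"
      using eventually_gt_at_top[of n]
    proof eventually_elim
      case (elim M)
      then show ?case
        using tail[of n "{..<M}"] by (simp add: fps_sum_nth subset_eq)
    qed
  qed
  then have "(\<Sum>w. h w) = Abs_fps (\<lambda>n. \<Sum>w\<le>n. h w $ n)"
    by (rule sums_unique[symmetric])
  then have "(\<Sum>w. h w) $ n = (\<Sum>w\<le>n. h w $ n)"
    by simp
  also have "\<dots> = (\<Sum>w\<le>N. h w $ n)"
    using tail[of n "{..N}"] assms(2) by simp
  finally show ?thesis .
qed

lemma suminf_fps_diff:
  fixes f g :: "nat \<Rightarrow> 'a::comm_ring_1 fps"
  assumes "adic_family f" "adic_family g"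
  shows "(\<Sum>w. f w - g w) = (\<Sum>w. f w) - (\<Sum>w. g w)"
proof -
  have "adic_family (\<lambda>w. f w - g w)"
    using assms by (simp add: adic_family_def)
  with assms show ?thesis
    by (simp add: fps_eq_iff suminf_fps_nth[OF _ order_refl] sum_subtractf)
qed

lemma suminf_fps_mult_left:
  fixes f :: "nat \<Rightarrow> 'a::comm_ring_1 fps"
  assumes "adic_family f"
  shows "(\<Sum>w. A * f w) = A * (\<Sum>w. f w)"
proof (rule fps_ext)
  fix n
  have "adic_family (\<lambda>w. A * f w)"
    using adic_family_mult[OF assms, of "\<lambda>_. A"] by (simp add: mult.commute)
  then have "(\<Sum>w. A * f w) $ n = (\<Sum>w\<le>n. \<Sum>i=0..n. A $ i * f w $ (n - i))"
    by (simp add: suminf_fps_nth[OF _ order_refl] fps_mult_nth)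
  also have "\<dots> = (\<Sum>i=0..n. A $ i * (\<Sum>w\<le>n. f w $ (n - i)))"
    by (subst sum.swap) (simp add: sum_distrib_left)
  also have "\<dots> = (A * (\<Sum>w. f w)) $ n"
    unfolding fps_mult_nth by (intro sum.cong refl) (simp add: suminf_fps_nth[OF assms, of _ n])
  finally show "(\<Sum>w. A * f w) $ n = (A * (\<Sum>w. f w)) $ n" .
qed

lemma suminf_fps_shift:
  fixes f :: "nat \<Rightarrow> 'a::comm_ring_1 fps"
  assumes "adic_family f"
  shows "(\<Sum>w. f w) = f 0 + (\<Sum>w. f (Suc w))"
proof (rule fps_ext)
  fix n
  have "adic_family (\<lambda>w. f (Suc w))"
    using assms by (simp add: adic_family_def)
  then have "(f 0 + (\<Sum>w. f (Suc w))) $ n = (\<Sum>w\<le>Suc n. f w $ n)"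
    by (subst sum.atMost_Suc_shift) (simp add: suminf_fps_nth[OF _ order_refl])
  then show "(\<Sum>w. f w) $ n = (f 0 + (\<Sum>w. f (Suc w))) $ n"
    using suminf_fps_nth[OF assms, of n "Suc n"] by simp
qed

lemma fps_mult_X_power_nth_less:
  fixes F :: "'a::comm_ring_1 fps"
  assumes "n < k"
  shows "(F * fps_X ^ k) $ n = 0"
  using assms by (simp add: fps_X_power_mult_right_nth)

text \<open>The library's infinite product requires a nonzero limit of the partial products, here
  guaranteed by the constant coefficient 1.\<close>

lemma qpoch_inf_tendsto:
  assumes "1 \<le> a" "1 \<le> m"
  shows "(\<lambda>N. \<Prod>k<N. 1 - Z * q_var ^ (a + m * k)) \<longlonglongrightarrow> qpoch_inf (Z * q_var ^ a) (q_var ^ m)"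
proof -
  define f :: "nat \<Rightarrow> series" where "f = (\<lambda>k. 1 - Z * q_var ^ (a + m * k))"
  define L where "L = Abs_fps (\<lambda>n. (\<Prod>k<n. f k) $ n)"
  have stable: "(\<Prod>k<N. f k) $ n = (\<Prod>k<n. f k) $ n" if "n \<le> N" for n N
    using that
  proof (induction N rule: dec_induct)
    case (step N)
    have "n < a + m * N"
    proof -
      have "1 * N \<le> m * N"
        using assms by (intro mult_le_mono1)
      then show ?thesis
        using step.hyps assms by linarith
    qed
    then have "((\<Prod>k<N. f k) * Z * fps_X ^ (a + m * N)) $ n = 0"
      by (rule fps_mult_X_power_nth_less)
    then show ?case
      using step.IH by (simp add: f_def q_var_def algebra_simps)
  qed simp
  have lim: "(\<lambda>N. \<Prod>k<N. f k) \<longlonglongrightarrow> L"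
  proof (rule tendsto_fpsI)
    fix n
    show "eventually (\<lambda>N. (\<Prod>k<N. f k) $ n = L $ n) sequentially"
      using eventually_ge_at_top[of n]
      unfolding L_def fps_nth_Abs_fps by eventually_elim (rule stable)
  qed
  have "L $ 0 = 1"
    by (simp add: L_def)
  then have "L \<noteq> 0"
    by auto
  then have "raw_has_prod f 0 L"
    using LIMSEQ_Suc[OF lim] by (simp add: raw_has_prod_def lessThan_Suc_atMost)
  then have "L = prodinf f"
    by (intro has_prod_unique) (simp add: has_prod_def)
  also have "\<dots> = qpoch_inf (Z * q_var ^ a) (q_var ^ m)"
    by (simp add: qpoch_inf_def f_def power_add power_mult mult.assoc)
  finally show ?thesis
    using lim by (simp add: f_def)
qed

section \<open>The q-binomial theorem\<close>

text \<open>For \<open>S(Y) = (\<Sum>w. c(w) Y^w)\<close>, the difference \<open>S(Y) - S(Y q^m)\<close> has terms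
  \<open>c(w) (1 - q^(mw)) Y^w\<close>, which the recurrence turns into multiples of \<open>c(w - 1)\<close>.\<close>

lemma q_binomial_functional_equation:
  fixes c :: "nat \<Rightarrow> series"
  assumes c: "adic_family c"
    and rec: "\<And>w. c (Suc w) * (1 - q_var ^ (m * Suc w)) = q_var ^ a * (1 - u * q_var ^ (m * w)) * c w"
  shows "(1 - Y * q_var ^ a) * (\<Sum>w. c w * Y ^ w) =
    (1 - u * Y * q_var ^ a) * (\<Sum>w. c w * (Y * q_var ^ m) ^ w)"
proof -
  define S where "S = (\<lambda>Z. \<Sum>w. c w * Z ^ w)"
  have fam: "adic_family (\<lambda>w. c w * Z ^ w)" for Z
    by (rule adic_family_mult[OF c])
  have fam': "adic_family (\<lambda>w. c w * (1 - q_var ^ (m * w)) * Y ^ w)"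
    by (intro adic_family_mult c)
  have "S Y - S (Y * q_var ^ m) = (\<Sum>w. c w * Y ^ w - c w * (Y * q_var ^ m) ^ w)"
    unfolding S_def by (rule suminf_fps_diff[OF fam fam, symmetric])
  also have "\<dots> = (\<Sum>w. c w * (1 - q_var ^ (m * w)) * Y ^ w)"
    by (intro suminf_cong) (simp add: power_mult_distrib algebra_simps flip: power_mult)
  also have "\<dots> = (\<Sum>w. c (Suc w) * (1 - q_var ^ (m * Suc w)) * Y ^ Suc w)"
    by (subst suminf_fps_shift[OF fam']) simp
  also have "\<dots> = (\<Sum>w. Y * q_var ^ a * (c w * Y ^ w) -
      u * Y * q_var ^ a * (c w * (Y * q_var ^ m) ^ w))"
    by (intro suminf_cong, subst rec)
      (simp add: power_mult_distrib algebra_simps flip: power_mult)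
  also have "\<dots> = Y * q_var ^ a * S Y - u * Y * q_var ^ a * S (Y * q_var ^ m)"
  proof -
    have "adic_family (\<lambda>w. A * (c w * Z ^ w))" for A Z
      using adic_family_mult[OF fam, of Z "\<lambda>_. A"] by (simp add: mult_ac)
    then show ?thesis
      unfolding S_def by (simp add: suminf_fps_diff suminf_fps_mult_left[OF fam])
  qed
  finally show ?thesis
    unfolding S_def by (simp add: algebra_simps)
qed

text \<open>The recurrence determines \<open>c\<close> from \<open>c 0\<close>, so this is the q-binomial theorem in base \<open>q^m\<close>
  scaled by \<open>c 0\<close>; stating it through the recurrence avoids dividing by \<open>1 - q^(mw)\<close>.\<close>

theorem q_binomial:
  fixes c :: "nat \<Rightarrow> series"
  assumes "1 \<le> a" "1 \<le> m" and c: "adic_family c"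
    and rec: "\<And>w. c (Suc w) * (1 - q_var ^ (m * Suc w)) = q_var ^ a * (1 - u * q_var ^ (m * w)) * c w"
  shows "qpoch_inf (Y * q_var ^ a) (q_var ^ m) * (\<Sum>w. c w * Y ^ w) =
    qpoch_inf (u * Y * q_var ^ a) (q_var ^ m) * c 0"
proof -
  define S where "S = (\<lambda>Z. \<Sum>w. c w * Z ^ w)"
  have fam: "adic_family (\<lambda>w. c w * Z ^ w)" for Z
    by (rule adic_family_mult[OF c])
  have iter: "(\<Prod>k<N. 1 - Y * q_var ^ (a + m * k)) * S Y =
      (\<Prod>k<N. 1 - u * Y * q_var ^ (a + m * k)) * S (Y * q_var ^ (m * N))" for N
  proof (induction N)
    case (Suc N)
    have eq: "(1 - Y * q_var ^ (a + m * N)) * S (Y * q_var ^ (m * N)) =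
        (1 - u * Y * q_var ^ (a + m * N)) * S (Y * q_var ^ (m * Suc N))"
      using q_binomial_functional_equation[OF c rec, of "Y * q_var ^ (m * N)"]
      by (simp add: S_def power_add mult_ac)
    have "(\<Prod>k<Suc N. 1 - Y * q_var ^ (a + m * k)) * S Y =
        (1 - Y * q_var ^ (a + m * N)) * ((\<Prod>k<N. 1 - Y * q_var ^ (a + m * k)) * S Y)"
      by (simp add: mult_ac)
    also have "\<dots> = (\<Prod>k<N. 1 - u * Y * q_var ^ (a + m * k)) *
        ((1 - Y * q_var ^ (a + m * N)) * S (Y * q_var ^ (m * N)))"
      unfolding Suc.IH by (simp only: mult_ac)
    finally show ?case
      unfolding eq by (simp add: mult_ac)
  qed simp
  \<comment> \<open>Every term but the one at \<open>w = 0\<close> is divisible by \<open>q^(mN)\<close>.\<close>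
  have S0: "(\<lambda>N. S (Y * q_var ^ (m * N))) \<longlonglongrightarrow> c 0"
  proof (rule tendsto_fpsI)
    fix n
    show "eventually (\<lambda>N. S (Y * q_var ^ (m * N)) $ n = c 0 $ n) sequentially"
      using eventually_gt_at_top[of n]
    proof eventually_elim
      case (elim N)
      have "(c w * (Y * q_var ^ (m * N)) ^ w) $ n = 0" if "w \<noteq> 0" for w
      proof -
        have "n < m * N * w"
        proof -
          have "1 * N * 1 \<le> m * N * w"
            using that assms(2) by (intro mult_le_mono) auto
          then show ?thesis
            using elim by linarith
        qed
        then have "((c w * Y ^ w) * fps_X ^ (m * N * w)) $ n = 0"
          by (rule fps_mult_X_power_nth_less)
        then show ?thesis
          by (simp add: power_mult_distrib mult_ac q_var_def flip: power_mult)
      qed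
      then have "(\<Sum>w\<le>n. (c w * (Y * q_var ^ (m * N)) ^ w) $ n) =
          (\<Sum>w\<in>{0}. (c w * (Y * q_var ^ (m * N)) ^ w) $ n)"
        by (intro sum.mono_neutral_right) auto
      then show ?case
        by (simp add: S_def suminf_fps_nth[OF fam order_refl])
    qed
  qed
  have "(\<lambda>N. (\<Prod>k<N. 1 - Y * q_var ^ (a + m * k)) * S Y)
      \<longlonglongrightarrow> qpoch_inf (Y * q_var ^ a) (q_var ^ m) * S Y"
    by (intro tendsto_mult_fps qpoch_inf_tendsto assms tendsto_const)
  moreover have "(\<lambda>N. (\<Prod>k<N. 1 - Y * q_var ^ (a + m * k)) * S Y)
      \<longlonglongrightarrow> qpoch_inf (u * Y * q_var ^ a) (q_var ^ m) * c 0"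
    unfolding iter by (intro tendsto_mult_fps qpoch_inf_tendsto assms S0)
  ultimately show ?thesis
    unfolding S_def by (rule LIMSEQ_unique)
qed

section \<open>Partitions into parts from an arithmetic progression\<close>

text \<open>The partitions of \<open>n\<close> into exactly \<open>w\<close> parts from \<open>a, a + m, a + 2m, \<dots>\<close>; for \<open>a \<ge> 1\<close> positivity
  of the parts is automatic.\<close>

definition ap_partitions :: "nat \<Rightarrow> nat \<Rightarrow> nat \<Rightarrow> nat \<Rightarrow> nat multiset set" where
  "ap_partitions a m w n =
    {\<mu>. size \<mu> = w \<and> sum_mset \<mu> = n \<and> (\<forall>p\<in>#\<mu>. a \<le> p \<and> [p = a] (mod m))}"

text \<open>Their generating function in \<open>q\<close> for fixed \<open>w\<close>, written \<open>g\<^sub>a(w)\<close> above.\<close>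

definition ap_series :: "nat \<Rightarrow> nat \<Rightarrow> nat \<Rightarrow> series" where
  "ap_series a m w = Abs_fps (\<lambda>n. of_nat (card (ap_partitions a m w n)))"

lemma finite_ap_partitions: "finite (ap_partitions a m w n)"
proof (rule finite_subset)
  have "p \<le> sum_mset \<mu>" if "p \<in># \<mu>" for p and \<mu> :: "nat multiset"
    using multi_member_split[OF that] by auto
  then show "ap_partitions a m w n \<subseteq> multisets_of_size {..n} w"
    by (auto simp: ap_partitions_def multisets_of_size_def)
qed (simp add: finite_multisets_of_size)

lemma ap_partitions_size_0: "ap_partitions a m 0 n = (if n = 0 then {{#}} else {})"
  by (auto simp: ap_partitions_def)

lemma size_le_ap_partition:
  assumes "1 \<le> a" "\<mu> \<in> ap_partitions a m w n"
  shows "w \<le> n"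
proof -
  have "size \<nu> \<le> sum_mset \<nu>" if "\<forall>p\<in>#\<nu>. a \<le> p" for \<nu> :: "nat multiset"
    using that assms(1) by (induction \<nu>) auto
  with assms(2) show ?thesis
    by (auto simp: ap_partitions_def)
qed

lemma adic_family_ap_series:
  assumes "1 \<le> a"
  shows "adic_family (ap_series a m)"
proof -
  have "ap_partitions a m w n = {}" if "n < w" for w n
    using size_le_ap_partition[OF assms, of _ m w n] that by (meson equals0I not_le)
  then show ?thesis
    by (simp add: adic_family_def ap_series_def)
qed

lemma ap_partitions_with_least_part:
  "{\<mu> \<in> ap_partitions a m (Suc w) n. a \<in># \<mu>} =
    (if a \<le> n then add_mset a ` ap_partitions a m w (n - a) else {})"
  (is "?L = ?R")
proof (intro set_eqI iffI)
  fix \<mu> assume "\<mu> \<in> ?L"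
  then obtain \<nu> where "\<mu> = add_mset a \<nu>" "\<mu> \<in> ap_partitions a m (Suc w) n"
    using multi_member_split[of a \<mu>] by blast
  then show "\<mu> \<in> ?R"
    by (auto simp: ap_partitions_def)
qed (auto simp: ap_partitions_def split: if_splits)

text \<open>A part of the progression other than \<open>a\<close> stays in it when \<open>m\<close> is subtracted.\<close>

lemma ap_partitions_without_least_part:
  assumes "1 \<le> m"
  shows "{\<mu> \<in> ap_partitions a m w n. a \<notin># \<mu>} =
    (if m * w \<le> n then image_mset (\<lambda>p. p + m) ` ap_partitions a m w (n - m * w) else {})"
  (is "?L = ?R")
proof (intro set_eqI iffI)
  have sum_shift: "sum_mset (image_mset (\<lambda>p. p + m) \<nu>) = sum_mset \<nu> + m * size \<nu>" for \<nu>
    by (induction \<nu>) auto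
  {
    fix \<mu> assume \<mu>: "\<mu> \<in> ?L"
    have large: "m \<le> p \<and> a \<le> p - m \<and> [p - m = a] (mod m)" if "p \<in># \<mu>" for p
    proof -
      from that \<mu> have "a \<le> p" "[p = a] (mod m)" "p \<noteq> a"
        by (auto simp: ap_partitions_def)
      then obtain k where k: "p = a + m * k" "k \<noteq> 0"
        by (metis cong_le_nat cong_sym add.commute mult_0_right add_0 mult.commute)
      then obtain j where "k = Suc j"
        using not0_implies_Suc by blast
      with k show ?thesis
        by (simp add: cong_def)
    qed
    define \<nu> where "\<nu> = image_mset (\<lambda>p. p - m) \<mu>"
    have "image_mset (\<lambda>p. p + m) \<nu> = image_mset (\<lambda>p. p) \<mu>"
      unfolding \<nu>_def multiset.map_comp o_def by (rule image_mset_cong) (use large in force)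
    then have eq: "\<mu> = image_mset (\<lambda>p. p + m) \<nu>"
      by simp
    have "size \<nu> = w" "\<forall>p\<in>#\<nu>. a \<le> p \<and> [p = a] (mod m)"
      using \<mu> large by (auto simp: \<nu>_def ap_partitions_def)
    moreover have "n = sum_mset \<nu> + m * w"
      using \<mu> sum_shift[of \<nu>] eq \<open>size \<nu> = w\<close> by (simp add: ap_partitions_def)
    ultimately show "\<mu> \<in> ?R"
      using eq by (auto simp: ap_partitions_def)
  next
    fix \<mu> assume "\<mu> \<in> ?R"
    then obtain \<nu> where \<nu>: "\<mu> = image_mset (\<lambda>p. p + m) \<nu>" "\<nu> \<in> ap_partitions a m w (n - m * w)"
      and "m * w \<le> n"
      by (auto split: if_splits)
    have "a < p \<and> [p = a] (mod m)" if "p \<in># \<mu>" for p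
      using that \<nu> assms by (force simp: ap_partitions_def cong_def)
    moreover have "size \<mu> = w" "sum_mset \<mu> = n"
      using \<nu> sum_shift[of \<nu>] \<open>m * w \<le> n\<close> by (auto simp: ap_partitions_def)
    ultimately show "\<mu> \<in> ?L"
      unfolding ap_partitions_def by (simp, metis less_irrefl less_imp_le)
  }
qed

lemma ap_series_0: "ap_series a m 0 = 1"
  by (simp add: fps_eq_iff ap_series_def ap_partitions_size_0)

lemma ap_series_Suc:
  assumes "1 \<le> m"
  shows "ap_series a m (Suc w) * (1 - q_var ^ (m * Suc w)) = q_var ^ a * ap_series a m w"
proof -
  let ?P = "ap_partitions a m"
  have "ap_series a m (Suc w) = q_var ^ a * ap_series a m w + q_var ^ (m * Suc w) * ap_series a m (Suc w)"
  proof (rule fps_ext)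
    fix n
    have "card (?P (Suc w) n) =
        card {\<mu> \<in> ?P (Suc w) n. a \<in># \<mu>} + card {\<mu> \<in> ?P (Suc w) n. a \<notin># \<mu>}"
      by (subst card_Un_disjoint[symmetric])
        (auto simp: finite_ap_partitions intro!: arg_cong[where f = card])
    also have "card {\<mu> \<in> ?P (Suc w) n. a \<in># \<mu>} = (if a \<le> n then card (?P w (n - a)) else 0)"
      unfolding ap_partitions_with_least_part by (auto simp: card_image inj_on_def)
    also have "card {\<mu> \<in> ?P (Suc w) n. a \<notin># \<mu>} =
        (if m * Suc w \<le> n then card (?P (Suc w) (n - m * Suc w)) else 0)"
    proof -
      have "inj (image_mset (\<lambda>p. p + m))"
        by (rule multiset.inj_map) (simp add: inj_on_def)
      then show ?thesis
        unfolding ap_partitions_without_least_part[OF assms]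
        by (auto simp: card_image inj_on_subset)
    qed
    finally show "ap_series a m (Suc w) $ n =
        (q_var ^ a * ap_series a m w + q_var ^ (m * Suc w) * ap_series a m (Suc w)) $ n"
      by (simp add: ap_series_def q_var_def fps_X_power_mult_nth)
  qed
  then show ?thesis
    by (simp add: algebra_simps)
qed

section \<open>Copartitions\<close>

text \<open>Copartitions with \<open>w\<close> ground and \<open>s\<close> sky parts correspond to pairs \<open>(\<gamma>, \<sigma>)\<close> of total size
  \<open>n - mws\<close>, graded by the size \<open>i\<close> of \<open>\<gamma>\<close>.\<close>

lemma cp_eq_sum:
  assumes "1 \<le> a" "1 \<le> b" "1 \<le> m"
  shows "cp a b m w s n = (if m * w * s \<le> n then
    \<Sum>i\<le>n - m * w * s. card (ap_partitions a m w i) * card (ap_partitions b m s (n - m * w * s - i)) else 0)"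
proof -
  let ?C = "{(\<gamma>, \<rho>, \<sigma>). is_copartition a b m (\<gamma>, \<rho>, \<sigma>) \<and>
     sum_mset \<gamma> + sum_mset \<rho> + sum_mset \<sigma> = n \<and> size \<gamma> = w \<and> size \<sigma> = s}"
  \<comment> \<open>The only possible \<open>\<rho>\<close>. For \<open>w = 0\<close> it is empty, whatever the number of sky parts.\<close>
  define r where "r = replicate_mset (if w = 0 then 0 else s) (m * w)"
  define D where "D = {(\<gamma>, \<sigma>). \<gamma> \<in> ap_partitions a m w (sum_mset \<gamma>) \<and>
      \<sigma> \<in> ap_partitions b m s (sum_mset \<sigma>) \<and> sum_mset \<gamma> + sum_mset \<sigma> + m * w * s = n}"
  have sum_r: "sum_mset r = m * w * s"
    by (simp add: r_def)
  have rho: "(if \<gamma> = {#} then \<rho> = {#} else size \<rho> = s \<and> (\<forall>p\<in>#\<rho>. p = m * w)) \<longleftrightarrow> \<rho> = r"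
    if "size \<gamma> = w" for \<gamma> \<rho> :: "nat multiset"
  proof -
    have "size \<rho> = s \<and> (\<forall>p\<in>#\<rho>. p = m * w) \<longleftrightarrow> \<rho> = replicate_mset s (m * w)"
      using set_mset_subset_singletonD[of \<rho> "m * w"] by (auto split: if_splits)
    moreover have "\<gamma> = {#} \<longleftrightarrow> w = 0"
      using that by auto
    ultimately show ?thesis
      unfolding r_def by (cases "w = 0") simp_all
  qed
  have pos: "is_partition \<mu>" if "\<mu> \<in> ap_partitions c m k l" "1 \<le> c" for \<mu> c k l
    using that by (force simp: is_partition_def ap_partitions_def)
  have "is_partition r"
    using assms by (auto simp: is_partition_def r_def)
  have char: "is_copartition a b m (\<gamma>, \<rho>, \<sigma>) \<and>
      sum_mset \<gamma> + sum_mset \<rho> + sum_mset \<sigma> = n \<and> size \<gamma> = w \<and> size \<sigma> = s \<longleftrightarrow>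
      \<rho> = r \<and> (\<gamma>, \<sigma>) \<in> D" (is "?lhs \<longleftrightarrow> ?rhs") for \<gamma> \<rho> \<sigma>
  proof
    assume ?lhs
    moreover from this have "\<rho> = r"
      using rho[of \<gamma> \<rho>] by (auto simp: is_copartition_def)
    ultimately show ?rhs
      by (auto simp: is_copartition_def D_def ap_partitions_def sum_r)
  next
    assume rhs: ?rhs
    then have mem: "\<gamma> \<in> ap_partitions a m w (sum_mset \<gamma>)" "\<sigma> \<in> ap_partitions b m s (sum_mset \<sigma>)"
      by (auto simp: D_def)
    have "if \<gamma> = {#} then \<rho> = {#} else size \<rho> = s \<and> (\<forall>p\<in>#\<rho>. p = m * w)"
      using rho[of \<gamma> \<rho>] mem(1) rhs by (simp add: ap_partitions_def)
    with rhs mem show ?lhs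
      using pos[OF mem(1)] pos[OF mem(2)] \<open>is_partition r\<close> assms sum_r
      unfolding is_copartition_def ap_partitions_def D_def by (auto split: if_splits)
  qed
  have "?C = (\<lambda>(\<gamma>, \<sigma>). (\<gamma>, r, \<sigma>)) ` D"
    unfolding char by force
  then have "cp a b m w s n = card D"
    unfolding cp_def by (simp add: card_image inj_on_def split: prod.splits)
  also have "D = (if m * w * s \<le> n then
      \<Union>i\<le>n - m * w * s. ap_partitions a m w i \<times> ap_partitions b m s (n - m * w * s - i) else {})"
    by (auto simp: D_def ap_partitions_def)
  also have "card \<dots> = (if m * w * s \<le> n then
    \<Sum>i\<le>n - m * w * s. card (ap_partitions a m w i) * card (ap_partitions b m s (n - m * w * s - i)) else 0)"
  proof -
    have "card (\<Union>i\<le>k. ap_partitions a m w i \<times> ap_partitions b m s (k - i)) =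
        (\<Sum>i\<le>k. card (ap_partitions a m w i) * card (ap_partitions b m s (k - i)))" for k
      by (subst card_UN_disjoint)
        (auto simp: finite_ap_partitions card_cartesian_product, auto simp: ap_partitions_def)
    then show ?thesis
      by (simp del: diff_diff_left)
  qed
  finally show ?thesis .
qed

lemma cp_series_nth:
  assumes "1 \<le> a" "1 \<le> b" "1 \<le> m"
  shows "(ap_series a m w * ap_series b m s * q_var ^ (m * w * s)) $ n = of_nat (cp a b m w s n)"
  unfolding cp_eq_sum[OF assms]
  unfolding q_var_def fps_X_power_mult_right_nth
  by (simp add: fps_mult_nth ap_series_def atLeast0AtMost not_less)

text \<open>Both sides have the same coefficient of \<open>q^n\<close>, a double sum over \<open>w, s \<le> n\<close>: a copartition of
  size \<open>n\<close> has at most \<open>n\<close> ground and at most \<open>n\<close> sky parts.\<close>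

lemma suminf_copartitions:
  assumes "1 \<le> a" "1 \<le> b" "1 \<le> m"
  shows "(\<Sum>n. \<Sum>w. \<Sum>s. of_nat (cp a b m w s n) * x_var ^ s * y_var ^ w * q_var ^ n) =
    (\<Sum>w. ap_series a m w * (\<Sum>s. ap_series b m s * (x_var * q_var ^ (m * w)) ^ s) * y_var ^ w)"
proof (rule fps_ext)
  fix n
  let ?x = "[:[:0, 1:]:] :: int poly poly" and ?y = "[:0, 1:] :: int poly poly"
  define t where "t = (\<lambda>w s n. of_nat (cp a b m w s n) * ?x ^ s * ?y ^ w)"
  have t_nth: "(ap_series a m w * ap_series b m s * (x_var * q_var ^ (m * w)) ^ s * y_var ^ w) $ n
      = t w s n" for w s n
  proof -
    have "ap_series a m w * ap_series b m s * (x_var * q_var ^ (m * w)) ^ s * y_var ^ w =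
        (ap_series a m w * ap_series b m s * q_var ^ (m * w * s)) * fps_const (?x ^ s * ?y ^ w)"
      by (simp add: x_var_def y_var_def power_mult_distrib fps_const_power mult_ac
          flip: fps_const_mult power_mult)
    then show ?thesis
      unfolding t_def fps_mult_right_const_nth cp_series_nth[OF assms]
      by (simp only: fps_mult_right_const_nth cp_series_nth[OF assms] mult.assoc[of "of_nat _"])
  qed
  have fam_a: "adic_family (ap_series a m)" and fam_b: "adic_family (ap_series b m)"
    using assms adic_family_ap_series by auto
  have t_w: "t w s n = 0" if "n < w" for w s n
    using adic_family_mult[OF fam_a, of "\<lambda>w. ap_series b m s * (x_var * q_var ^ (m * w)) ^ s * y_var ^ w"]
      that unfolding adic_family_def t_nth[symmetric] by (simp add: mult.assoc)
  have t_s: "t w s n = 0" if "n < s" for w s n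
    using adic_family_mult[OF fam_b, of "\<lambda>s. ap_series a m w * (x_var * q_var ^ (m * w)) ^ s * y_var ^ w"]
      that unfolding adic_family_def t_nth[symmetric] by (simp add: mult_ac)
  have const: "of_nat (cp a b m w s n) * x_var ^ s * y_var ^ w * q_var ^ n = fps_const (t w s n) * fps_X ^ n"
    for w s n
    by (simp add: t_def x_var_def y_var_def q_var_def fps_const_power fps_of_nat[symmetric]
        flip: fps_const_mult)
  have inner: "(\<Sum>w. \<Sum>s. of_nat (cp a b m w s n) * x_var ^ s * y_var ^ w * q_var ^ n) =
      fps_const (\<Sum>w\<le>n. \<Sum>s\<le>n. t w s n) * fps_X ^ n" for n
  proof -
    have "(\<Sum>w. \<Sum>s. fps_const (t w s n) * fps_X ^ n) =
        (\<Sum>w. \<Sum>s\<le>n. fps_const (t w s n) * fps_X ^ n)"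
      by (intro suminf_cong suminf_finite) (auto simp: t_s)
    also have "\<dots> = (\<Sum>w\<le>n. \<Sum>s\<le>n. fps_const (t w s n) * fps_X ^ n)"
      by (intro suminf_finite) (auto simp: t_w)
    also have "\<dots> = fps_const (\<Sum>w\<le>n. \<Sum>s\<le>n. t w s n) * fps_X ^ n"
      by (simp add: fps_eq_iff fps_sum_nth sum_distrib_right)
    finally show ?thesis
      unfolding const .
  qed
  have "adic_family (\<lambda>n. fps_const (\<Sum>w\<le>n. \<Sum>s\<le>n. t w s n) * fps_X ^ n)"
    by (simp add: adic_family_def)
  then have "(\<Sum>n. \<Sum>w. \<Sum>s. of_nat (cp a b m w s n) * x_var ^ s * y_var ^ w * q_var ^ n) $ n =
      (\<Sum>k\<le>n. (fps_const (\<Sum>w\<le>k. \<Sum>s\<le>k. t w s k) * fps_X ^ k) $ n)"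
    unfolding inner by (rule suminf_fps_nth) simp
  also have "\<dots> = (\<Sum>k\<le>n. if k = n then \<Sum>w\<le>n. \<Sum>s\<le>n. t w s n else 0)"
    by (intro sum.cong) auto
  also have "\<dots> = (\<Sum>w\<le>n. \<Sum>s\<le>n. t w s n)"
    by simp
  also have "\<dots> = (\<Sum>w\<le>n. (ap_series a m w *
      (\<Sum>s. ap_series b m s * (x_var * q_var ^ (m * w)) ^ s) * y_var ^ w) $ n)"
  proof (intro sum.cong refl)
    fix w
    have fam: "adic_family (\<lambda>s. ap_series b m s * (x_var * q_var ^ (m * w)) ^ s)"
      by (rule adic_family_mult[OF fam_b])
    have "ap_series a m w * (\<Sum>s. ap_series b m s * (x_var * q_var ^ (m * w)) ^ s) * y_var ^ w =
        (ap_series a m w * y_var ^ w) * (\<Sum>s. ap_series b m s * (x_var * q_var ^ (m * w)) ^ s)"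
      by (simp only: mult_ac)
    also have "\<dots> = (\<Sum>s. (ap_series a m w * y_var ^ w) * (ap_series b m s * (x_var * q_var ^ (m * w)) ^ s))"
      by (rule suminf_fps_mult_left[OF fam, symmetric])
    also have "\<dots> = (\<Sum>s. ap_series b m s * (ap_series a m w * (x_var * q_var ^ (m * w)) ^ s * y_var ^ w))"
      by (simp only: mult_ac)
    also have "\<dots> $ n = (\<Sum>s\<le>n. (ap_series b m s * (ap_series a m w * (x_var * q_var ^ (m * w)) ^ s * y_var ^ w)) $ n)"
      by (rule suminf_fps_nth[OF adic_family_mult[OF fam_b] order_refl])
    also have "\<dots> = (\<Sum>s\<le>n. t w s n)"
      unfolding t_nth[symmetric] by (simp only: mult_ac)
    finally show "(\<Sum>s\<le>n. t w s n) = (ap_series a m w *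
        (\<Sum>s. ap_series b m s * (x_var * q_var ^ (m * w)) ^ s) * y_var ^ w) $ n" ..
  qed
  also have "\<dots> = (\<Sum>w. ap_series a m w *
      (\<Sum>s. ap_series b m s * (x_var * q_var ^ (m * w)) ^ s) * y_var ^ w) $ n"
    by (rule suminf_fps_nth[symmetric, OF _ order_refl]) (intro adic_family_mult fam_a)
  finally show "(\<Sum>n. \<Sum>w. \<Sum>s. of_nat (cp a b m w s n) * x_var ^ s * y_var ^ w * q_var ^ n) $ n =
      (\<Sum>w. ap_series a m w *
      (\<Sum>s. ap_series b m s * (x_var * q_var ^ (m * w)) ^ s) * y_var ^ w) $ n" .
qed

lemma qpoch_inf_nth_0:
  assumes "1 \<le> a" "1 \<le> m"
  shows "qpoch_inf (Z * q_var ^ a) (q_var ^ m) $ 0 = 1"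
proof -
  let ?p = "\<lambda>N. \<Prod>k<N. 1 - Z * q_var ^ (a + m * k)"
  have "?p N $ 0 = 1" for N
    using assms by (induction N) (auto simp: q_var_def)
  moreover have "eventually (\<lambda>N. ?p N $ 0 = qpoch_inf (Z * q_var ^ a) (q_var ^ m) $ 0) sequentially"
    using qpoch_inf_tendsto[OF assms, of Z] by (simp add: tendsto_fps_iff)
  ultimately show ?thesis
    by simp
qed

theorem theorem3p6:
  fixes a b m :: nat
  assumes "a \<ge> 1" "b \<ge> 1" "m \<ge> 1"
  shows "(\<Sum>n. \<Sum>w. \<Sum>s. of_nat (cp a b m w s n) * x_var ^ s * y_var ^ w * q_var ^ n) =
    fps_quot (qpoch_inf (x_var * y_var * q_var ^ (a + b)) (q_var ^ m))
      (qpoch_inf (x_var * q_var ^ b) (q_var ^ m) * qpoch_inf (y_var * q_var ^ a) (q_var ^ m))"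
proof -
  let ?G = "ap_series a m" and ?X = "qpoch_inf (x_var * q_var ^ b) (q_var ^ m)"
    and ?Y = "qpoch_inf (y_var * q_var ^ a) (q_var ^ m)"
    and ?XY = "qpoch_inf (x_var * y_var * q_var ^ (a + b)) (q_var ^ m)"
  define P where "P = (\<lambda>Z. \<Sum>s. ap_series b m s * Z ^ s)"
  define c where "c = (\<lambda>w. ?G w * P (x_var * q_var ^ (m * w)))"
  have fam: "adic_family (ap_series a m)" "adic_family (ap_series b m)"
    using assms adic_family_ap_series by auto
  have sky: "?X * P x_var = 1"
  proof -
    have "qpoch_inf (0 * x_var * q_var ^ b) (q_var ^ m) = 1"
      using has_prod_unique[of "\<lambda>_. 1 :: series" 1]
      by (simp add: qpoch_inf_def has_prod_def raw_has_prod_def)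
    then show ?thesis
      using q_binomial[OF assms(2,3) fam(2), of 0 x_var] ap_series_Suc[OF assms(3), of b]
      by (simp add: P_def ap_series_0)
  qed
  have P_shift: "P (Z * q_var ^ m) = (1 - Z * q_var ^ b) * P Z" for Z
    using q_binomial_functional_equation[OF fam(2), of m b 0 Z] ap_series_Suc[OF assms(3), of b]
    by (simp add: P_def)
  have rec: "c (Suc w) * (1 - q_var ^ (m * Suc w)) =
      q_var ^ a * (1 - x_var * q_var ^ b * q_var ^ (m * w)) * c w" for w
  proof -
    have "c (Suc w) * (1 - q_var ^ (m * Suc w)) =
        (?G (Suc w) * (1 - q_var ^ (m * Suc w))) * P (x_var * q_var ^ (m * w) * q_var ^ m)"
      by (simp add: c_def power_add mult_ac)
    then show ?thesis
      unfolding ap_series_Suc[OF assms(3)] P_shift by (simp add: c_def mult_ac)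
  qed
  have "adic_family c"
    unfolding c_def by (rule adic_family_mult[OF fam(1)])
  from q_binomial[OF assms(1,3) this rec, of y_var]
  have ground: "?Y * (\<Sum>w. c w * y_var ^ w) = ?XY * P x_var"
    by (simp add: c_def ap_series_0 power_add mult_ac)
  have "?XY = ?XY * (?X * P x_var)"
    by (simp add: sky)
  also have "\<dots> = ?X * (?XY * P x_var)"
    by (simp only: mult_ac)
  also have "\<dots> = (\<Sum>w. c w * y_var ^ w) * (?X * ?Y)"
    unfolding ground[symmetric] by (simp only: mult_ac)
  finally have "fps_quot ?XY (?X * ?Y) = (\<Sum>w. c w * y_var ^ w)"
    using assms by (subst fps_quot_eq_iff) (simp_all add: qpoch_inf_nth_0)
  then show ?thesis
    by (simp add: suminf_copartitions[OF assms] c_def P_def)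
qed

end
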